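(* Let $k\ge1$ be an integer. We have $$N^{k(k-1)\cdots1}_{2\text{-}13}(n)=\begin{cases}C_{n-k+1},&\text{if }n\ge k,\\ 0,&\text{otherwise.}\end{cases}$$
   Context: A permutation $\pi=\pi_1\cdots\pi_n$ of $\{1,\dots,n\}$ contains the generalized pattern $2\text{-}13$ if there are indices $i<j<n$ such that $\pi_i\pi_j\pi_{j+1}$ is order-isomorphic to $213$; otherwise it avoids it. A permutation $\pi$ begins with a pattern $p=p_1\cdots p_k$ if $n\ge k$ and $\pi_1\cdots\pi_k$ is order-isomorphic to $p$; in addition, by convention, the empty permutation is assumed to begin with the pattern $1$. $N^p_q(n)$ is the number of permutations of $\{1,\dots,n\}$ that avoid $q$ and begin with $p$. $C_m=\frac{1}{m+1}\binom{2m}{m}$ is the $m$th Catalan number.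
   Formalization: The case k = 1, n = 0 is excluded: by the convention that the empty permutation begins with the pattern 1, the count there is 1, while the displayed formula gives 0. *)

theory Defs
  imports Complex_Main "HOL-Combinatorics.Multiset_Permutations"
begin

(* A permutation of {1..n} is its word, an element of permutations_of_set {1..n}.
   List positions are counted from 0, so xs ! i is the (i+1)-st letter. *)

definition order_isomorphic :: "nat list \<Rightarrow> nat list \<Rightarrow> bool" where
  "order_isomorphic xs ys \<longleftrightarrow>
     length xs = length ys \<and>
     (\<forall>i<length xs. \<forall>j<length xs. xs ! i < xs ! j \<longleftrightarrow> ys ! i < ys ! j)"

definition contains_2_13 :: "nat list \<Rightarrow> bool" where
  "contains_2_13 \<pi> \<longleftrightarrow>
     (\<exists>i j. i < j \<and> j + 1 < length \<pi> \<and>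
            order_isomorphic [\<pi> ! i, \<pi> ! j, \<pi> ! (j + 1)] [2, 1, 3])"

(* The second disjunct is the convention that the empty permutation begins with the pattern 1. *)
definition begins_with :: "nat list \<Rightarrow> nat list \<Rightarrow> bool" where
  "begins_with \<pi> p \<longleftrightarrow>
     (length p \<le> length \<pi> \<and> order_isomorphic (take (length p) \<pi>) p) \<or>
     (\<pi> = [] \<and> p = [1])"

(* The avoided pattern q enters as the predicate "contains q" on words. *)
definition num_avoiding_beginning ::
    "(nat list \<Rightarrow> bool) \<Rightarrow> nat list \<Rightarrow> nat \<Rightarrow> nat" where
  "num_avoiding_beginning contains_q p n =
     card {\<pi> \<in> permutations_of_set {1..n}. \<not> contains_q \<pi> \<and> begins_with \<pi> p}"

definition catalan :: "nat \<Rightarrow> real" where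
  "catalan m = 1 / (real m + 1) * real ((2 * m) choose m)"

(* Because of the convention on the empty permutation the count is 1, not 0, for the
   pattern 1 and n = 0. *)
lemma num_avoiding_beginning_2_13_empty: "num_avoiding_beginning contains_2_13 [1] 0 = 1"
proof -
  have "{\<pi> \<in> permutations_of_set {1..0::nat}. \<not> contains_2_13 \<pi> \<and> begins_with \<pi> [1]} = {[]}"
    by (auto simp: contains_2_13_def begins_with_def)
  then show ?thesis
    by (simp add: num_avoiding_beginning_def)
qed

end

theory Submission
  imports Defs "HOL-Computational_Algebra.Formal_Power_Series"
begin

text \<open>
  A word \<open>x # w\<close> avoids 2-13 iff \<open>w\<close> does and no ascent of \<open>w\<close> jumps over \<open>x\<close>, that is, iff
  in \<open>w\<close> all letters larger than \<open>x\<close> precede all smaller ones. Splitting off the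
  first letter therefore gives the Catalan convolution, which settles \<open>k = 1\<close>. If the word also
  starts with a descent, then no letter is larger than \<open>x\<close>, so \<open>x\<close> is the maximum; deleting it
  lowers both \<open>k\<close> and \<open>n\<close> by one.
\<close>

section \<open>The Catalan recurrence\<close>

lemma central_binomial_Suc:
  "real (n + 1) * real ((2 * Suc n) choose Suc n) = 2 * (2 * real n + 1) * real ((2 * n) choose n)"
proof -
  have Suc: "real ((2 * Suc n) choose Suc n) =
      ((2 * real n + 2) * (2 * real n + 1) * fact (2 * n)) / (((real n + 1) * fact n) * ((real n + 1) * fact n))"
    by (subst binomial_fact) (simp_all add: algebra_simps)
  have n: "real ((2 * n) choose n) = fact (2 * n) / (fact n * fact n)"
    by (simp add: binomial_fact)
  show ?thesis
    unfolding Suc n by (simp add: divide_simps) (simp add: algebra_simps)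
qed

text \<open>Together with the value at 0 this recurrence determines \<open>catalan\<close>; matching
  it identifies \<open>catalan\<close> with a generalized binomial coefficient.\<close>

lemma catalan_Suc: "(real n + 2) * catalan (Suc n) = 2 * (2 * real n + 1) * catalan n"
proof -
  have "(real n + 2) * catalan (Suc n) = real ((2 * Suc n) choose Suc n)"
    by (simp add: catalan_def divide_simps del: binomial_Suc_Suc mult_Suc_right)
  moreover have "(real n + 1) * catalan n = real ((2 * n) choose n)"
    by (simp add: catalan_def)
  \<comment> \<open>The extra factor \<open>real n + 1\<close> brings both sides to central binomial
    coefficients; it is nonzero and cancels at the end.\<close>
  ultimately have "(real n + 1) * ((real n + 2) * catalan (Suc n)) =
      (real n + 1) * (2 * (2 * real n + 1) * catalan n)"
    using central_binomial_Suc[of n] by (simp add: mult_ac add_ac del: binomial_Suc_Suc mult_Suc_right)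
  then show ?thesis by (simp add: add_eq_0_iff)
qed

text \<open>The coefficients of the generating function \<open>(1 - sqrt (1 - 4 * x)) / (2 * x)\<close>.\<close>

lemma catalan_gbinomial: "catalan n = 2 * (- 4) ^ n * ((1 / 2 :: real) gchoose Suc n)"
proof (induction n)
  case 0
  then show ?case by (simp add: catalan_def)
next
  case (Suc n)
  \<comment> \<open>Absorption for the upper index 1/2. Multiplied by -4, the factor
    \<open>1 / 2 - (real n + 1)\<close> becomes \<open>2 * (2 * real n + 1)\<close>, the one in
    \<open>catalan_Suc\<close>.\<close>
  have "(real n + 2) * ((1 / 2 :: real) gchoose Suc (Suc n))
      = (1 / 2 - (real n + 1)) * ((1 / 2 :: real) gchoose Suc n)"
    using gbinomial_mult_1[of "1/2::real" "Suc n"] by (simp add: algebra_simps)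
  moreover have "(real n + 2) * (2 * (- 4) ^ Suc n * ((1 / 2 :: real) gchoose Suc (Suc n)))
      = 2 * (- 4) ^ Suc n * ((real n + 2) * ((1 / 2 :: real) gchoose Suc (Suc n)))"
    by simp
  ultimately have "(real n + 2) * (2 * (- 4) ^ Suc n * ((1 / 2 :: real) gchoose Suc (Suc n)))
      = 2 * (2 * real n + 1) * (2 * (- 4) ^ n * ((1 / 2 :: real) gchoose Suc n))"
    by (simp only:) (simp add: algebra_simps)
  then have "(real n + 2) * (2 * (- 4) ^ Suc n * ((1 / 2 :: real) gchoose Suc (Suc n)))
      = (real n + 2) * catalan (Suc n)"
    unfolding catalan_Suc Suc.IH .
  moreover have "real n + 2 \<noteq> 0" by linarith
  ultimately show ?case by (metis mult_left_cancel)
qed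

text \<open>The square of the series of sqrt(1 + x) is 1 + x, so its coefficients vanish from degree
  2 on. In such a coefficient the two end terms are equal, and multiplying the inner terms by
  \<open>4 * (- 4) ^ n\<close> yields the products of Catalan numbers.\<close>

lemma catalan_convolution: "catalan (Suc n) = (\<Sum>i\<le>n. catalan i * catalan (n - i))"
proof -
  let ?g = "\<lambda>k. (1 / 2 :: real) gchoose k"
  have "(\<Sum>k\<in>{0..Suc (Suc n)}. ?g k * ?g (Suc (Suc n) - k)) = of_nat 1 gchoose Suc (Suc n)"
    using gbinomial_Vandermonde[of "1/2::real" "1/2" "Suc (Suc n)"] by simp
  also have "\<dots> = 0"
    by (simp only: binomial_gbinomial[symmetric]) simp
  finally have "(\<Sum>k\<le>Suc (Suc n). ?g k * ?g (Suc (Suc n) - k)) = 0"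
    by (simp only: atLeast0AtMost)
  \<comment> \<open>The shift detaches the term for index 0; the last term, equal to it, is detached
    in the next step, whence the factor -2.\<close>
  moreover have "(\<Sum>k\<le>Suc (Suc n). ?g k * ?g (Suc (Suc n) - k))
      = ?g (Suc (Suc n)) + (\<Sum>k\<le>Suc n. ?g (Suc k) * ?g (Suc n - k))"
    by (subst sum.atMost_Suc_shift) (simp del: sum.atMost_Suc)
  ultimately have "(\<Sum>k\<le>n. ?g (Suc k) * ?g (Suc n - k)) = - 2 * ?g (Suc (Suc n))"
    by simp
  moreover have "(\<Sum>i\<le>n. catalan i * catalan (n - i))
      = (\<Sum>i\<le>n. 4 * (- 4) ^ n * (?g (Suc i) * ?g (Suc n - i)))"
    by (rule sum.cong)
       (auto simp: catalan_gbinomial Suc_diff_le power_add[symmetric] mult_ac)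
  ultimately show ?thesis
    by (simp add: catalan_gbinomial sum_distrib_left[symmetric])
qed

section \<open>Avoiders of 2-13\<close>

lemma contains_2_13_iff:
  "contains_2_13 \<pi> \<longleftrightarrow>
     (\<exists>i j. i < j \<and> Suc j < length \<pi> \<and> \<pi> ! j < \<pi> ! i \<and> \<pi> ! i < \<pi> ! Suc j)"
proof -
  have "order_isomorphic [a, b, c] [2, 1, 3] \<longleftrightarrow> b < a \<and> a < c" for a b c
    by (auto simp: order_isomorphic_def All_less_Suc numeral_3_eq_3)
  then show ?thesis
    unfolding contains_2_13_def by simp
qed

lemma contains_2_13_Nil [simp]: "\<not> contains_2_13 []"
  by (simp add: contains_2_13_iff)

text \<open>The adjacent letters 13 come after the letter 2, so they always lie in
  \<open>xs\<close>. Either the 2 lies there as well, or it is \<open>x\<close> and 13 is an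
  adjacent pair stepping from below \<open>x\<close> to above it.\<close>

lemma contains_2_13_Cons:
  "contains_2_13 (x # xs) \<longleftrightarrow>
     contains_2_13 xs \<or> \<not> successively (\<lambda>y z. y < x \<longrightarrow> \<not> x < z) xs"
proof
  assume "contains_2_13 (x # xs)"
  then obtain i j where "i < j" "j < length xs" "(x # xs) ! j < (x # xs) ! i" "(x # xs) ! i < xs ! j"
    by (auto simp: contains_2_13_iff)
  then show "contains_2_13 xs \<or> \<not> successively (\<lambda>y z. y < x \<longrightarrow> \<not> x < z) xs"
    by (cases i; cases j)
       (auto simp: contains_2_13_iff successively_conv_nth)
next
  assume "contains_2_13 xs \<or> \<not> successively (\<lambda>y z. y < x \<longrightarrow> \<not> x < z) xs"
  then show "contains_2_13 (x # xs)"
  proof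
    assume "contains_2_13 xs"
    then obtain i j where "i < j" "Suc j < length xs" "xs ! j < xs ! i" "xs ! i < xs ! Suc j"
      by (auto simp: contains_2_13_iff)
    then show ?thesis
      unfolding contains_2_13_iff
      by (intro exI[of _ "Suc i"] exI[of _ "Suc j"]) auto
  next
    assume "\<not> successively (\<lambda>y z. y < x \<longrightarrow> \<not> x < z) xs"
    then obtain j where "Suc j < length xs" "xs ! j < x" "x < xs ! Suc j"
      by (auto simp: successively_conv_nth)
    then show ?thesis
      unfolding contains_2_13_iff
      by (intro exI[of _ 0] exI[of _ "Suc j"]) auto
  qed
qed

lemma successively_no_jump_append:
  fixes x :: "'a::linorder"
  assumes "\<forall>y\<in>set ys. y < x"
  shows "successively (\<lambda>y z. y < x \<longrightarrow> \<not> x < z) (xs @ ys) \<longleftrightarrow>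
         successively (\<lambda>y z. y < x \<longrightarrow> \<not> x < z) xs"
proof -
  have "successively (\<lambda>y z. y < x \<longrightarrow> \<not> x < z) ys"
    using assms by (auto simp: successively_conv_nth dest!: nth_mem)
  moreover have "ys = [] \<or> hd ys < x"
    using assms by (cases ys) auto
  ultimately show ?thesis
    by (auto simp: successively_append_iff)
qed

text \<open>Since \<open>x\<close> itself does not occur, every letter is strictly above or below
  it; after a first letter below \<open>x\<close>, a return above \<open>x\<close> would have to
  jump over \<open>x\<close>.\<close>

lemma successively_no_jump_iff:
  fixes x :: "'a::linorder"
  assumes "x \<notin> set xs"
  shows "successively (\<lambda>y z. y < x \<longrightarrow> \<not> x < z) xs \<longleftrightarrow>
    (\<exists>as bs. xs = as @ bs \<and> (\<forall>a\<in>set as. x < a) \<and> (\<forall>b\<in>set bs. b < x))"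
proof
  assume "successively (\<lambda>y z. y < x \<longrightarrow> \<not> x < z) xs"
  then show "\<exists>as bs. xs = as @ bs \<and> (\<forall>a\<in>set as. x < a) \<and> (\<forall>b\<in>set bs. b < x)"
    using assms
  proof (induction xs)
    case Nil
    then show ?case by simp
  next
    case (Cons y ys)
    then obtain as bs where ys: "ys = as @ bs" "\<forall>a\<in>set as. x < a" "\<forall>b\<in>set bs. b < x"
      by (auto simp: successively_Cons)
    show ?case
    proof (cases "x < y")
      case True
      with ys show ?thesis by (intro exI[of _ "y # as"] exI[of _ bs]) auto
    next
      case False
      with Cons.prems have "y < x" by auto
      \<comment> \<open>A nonempty \<open>as\<close> would start with a letter above
        \<open>x\<close> directly after \<open>y\<close>, which is a jump.\<close>
      with Cons.prems(1) ys have "as = []"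
        by (cases as) (auto simp: successively_Cons)
      with ys \<open>y < x\<close> show ?thesis by (intro exI[of _ "[]"] exI[of _ "y # ys"]) auto
    qed
  qed
next
  assume "\<exists>as bs. xs = as @ bs \<and> (\<forall>a\<in>set as. x < a) \<and> (\<forall>b\<in>set bs. b < x)"
  then obtain as bs where xs: "xs = as @ bs" "\<forall>a\<in>set as. x < a" "\<forall>b\<in>set bs. b < x" by blast
  have "successively (\<lambda>y z. y < x \<longrightarrow> \<not> x < z) as"
    using xs(2) by (auto simp: successively_conv_nth) (meson Suc_lessD less_asym nth_mem)
  with xs show "successively (\<lambda>y z. y < x \<longrightarrow> \<not> x < z) xs"
    by (simp add: successively_no_jump_append)
qed

text \<open>If the 2 lies in \<open>as\<close>, the larger 3 cannot lie in \<open>bs\<close>, so the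
  whole occurrence lies in \<open>as\<close>; if the 2 lies in \<open>bs\<close>, so does all that
  follows.\<close>

lemma contains_2_13_append:
  assumes "\<forall>a\<in>set as. \<forall>b\<in>set bs. b < a"
  shows "contains_2_13 (as @ bs) \<longleftrightarrow> contains_2_13 as \<or> contains_2_13 bs"
  using assms by (induction as) (auto simp: contains_2_13_Cons successively_no_jump_append)

text \<open>Arbitrary letter sets are allowed because the two blocks behind the first letter are
  words over subsets of the original letters.\<close>

definition avoiders_2_13 :: "nat set \<Rightarrow> nat list set" where
  "avoiders_2_13 S = {\<pi> \<in> permutations_of_set S. \<not> contains_2_13 \<pi>}"

lemma avoiders_2_13_iff:
  "\<pi> \<in> avoiders_2_13 S \<longleftrightarrow> set \<pi> = S \<and> distinct \<pi> \<and> \<not> contains_2_13 \<pi>"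
  by (auto simp: avoiders_2_13_def permutations_of_set_def)

lemma finite_avoiders_2_13: "finite (avoiders_2_13 S)"
  by (simp add: avoiders_2_13_def)

lemma Cons_in_avoiders_2_13_iff:
  "x # xs \<in> avoiders_2_13 S \<longleftrightarrow>
   x \<in> S \<and> (\<exists>as bs. xs = as @ bs \<and> as \<in> avoiders_2_13 {y \<in> S. x < y} \<and> bs \<in> avoiders_2_13 {y \<in> S. y < x})"
proof
  assume L: "x # xs \<in> avoiders_2_13 S"
  then have x: "x \<notin> set xs" "distinct xs" "x \<in> S" and set: "set xs = S - {x}"
    and avoid: "\<not> contains_2_13 xs" "successively (\<lambda>y z. y < x \<longrightarrow> \<not> x < z) xs"
    unfolding avoiders_2_13_iff contains_2_13_Cons by auto
  from avoid(2) obtain as bs where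
    xs: "xs = as @ bs" "\<forall>a\<in>set as. x < a" "\<forall>b\<in>set bs. b < x"
    unfolding successively_no_jump_iff[OF x(1)] by blast
  then have "\<forall>a\<in>set as. \<forall>b\<in>set bs. b < a" by force
  with avoid(1) xs(1) have "\<not> contains_2_13 as" "\<not> contains_2_13 bs"
    using contains_2_13_append by blast+
  moreover have "set as = {y \<in> S. x < y}" "set bs = {y \<in> S. y < x}"
  proof -
    have "set as = {y \<in> set xs. x < y}" "set bs = {y \<in> set xs. y < x}"
      unfolding xs(1) set_append using xs(2,3) by (blast dest: less_asym)+
    then show "set as = {y \<in> S. x < y}" "set bs = {y \<in> S. y < x}"
      unfolding set by blast+
  qed
  moreover have "distinct as" "distinct bs"
    using x(2) xs(1) by simp_all
  ultimately show "x \<in> S \<and> (\<exists>as bs. xs = as @ bs \<and> as \<in> avoiders_2_13 {y \<in> S. x < y} \<and>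
      bs \<in> avoiders_2_13 {y \<in> S. y < x})"
    unfolding avoiders_2_13_iff using x(3) xs(1) by blast
next
  assume "x \<in> S \<and> (\<exists>as bs. xs = as @ bs \<and> as \<in> avoiders_2_13 {y \<in> S. x < y} \<and>
      bs \<in> avoiders_2_13 {y \<in> S. y < x})"
  then obtain as bs where x: "x \<in> S" "xs = as @ bs"
    and as: "set as = {y \<in> S. x < y}" "distinct as" "\<not> contains_2_13 as"
    and bs: "set bs = {y \<in> S. y < x}" "distinct bs" "\<not> contains_2_13 bs"
    unfolding avoiders_2_13_iff by blast
  then have less: "\<forall>a\<in>set as. x < a" "\<forall>b\<in>set bs. b < x" "\<forall>a\<in>set as. \<forall>b\<in>set bs. b < a"
    by auto
  have notin: "x \<notin> set xs" using x(2) as(1) bs(1) by simp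
  have "successively (\<lambda>y z. y < x \<longrightarrow> \<not> x < z) xs"
    unfolding successively_no_jump_iff[OF notin] using x(2) less by blast
  moreover have "\<not> contains_2_13 xs"
    using as(3) bs(3) less(3) x(2) by (simp add: contains_2_13_append)
  moreover have "set (x # xs) = S"
    unfolding x(2) set_simps set_append as(1) bs(1) using x(1) by (auto simp: not_less)
  moreover have "distinct xs"
    using as(2) bs(2) less(3) x(2) by auto
  ultimately show "x # xs \<in> avoiders_2_13 S"
    using notin unfolding avoiders_2_13_iff contains_2_13_Cons by simp
qed

text \<open>The first letter \<open>m + i\<close> leaves \<open>i\<close> smaller and
  \<open>n - i\<close> larger letters. Both intervals are written as start plus length, the form in
  which the count is proved by induction.\<close>

lemma avoiders_2_13_interval_Suc:
  "avoiders_2_13 {m..<m + Suc n} =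
   (\<Union>i\<le>n. (\<lambda>(bs, as). (m + i) # as @ bs) `
     (avoiders_2_13 {m..<m + i} \<times> avoiders_2_13 {m + Suc i..<m + Suc i + (n - i)}))"
    (is "?L = ?R")
proof -
  have above: "{y \<in> {m..<m + Suc n}. m + i < y} = {m + Suc i..<m + Suc i + (n - i)}"
    and below: "{y \<in> {m..<m + Suc n}. y < m + i} = {m..<m + i}" if "i \<le> n" for i
    using that by auto
  have "\<pi> \<in> ?L \<longleftrightarrow> \<pi> \<in> ?R" for \<pi>
  proof (cases \<pi>)
    case Nil
    then show ?thesis by (auto simp: avoiders_2_13_iff)
  next
    case (Cons x xs)
    show ?thesis
    proof (cases "x \<in> {m..<m + Suc n}")
      case True
      then obtain i where i: "x = m + i" "i \<le> n"
        by (metis add_less_cancel_left atLeastLessThan_iff le_iff_add less_Suc_eq_le)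
      show ?thesis
        using i(2) unfolding Cons i(1) Cons_in_avoiders_2_13_iff above[OF i(2)] below[OF i(2)]
        by (auto simp: image_iff)
    next
      case False
      then show ?thesis
        unfolding Cons Cons_in_avoiders_2_13_iff by auto
    qed
  qed
  then show ?thesis by blast
qed

text \<open>Only the number of letters matters; the start \<open>m\<close> stays arbitrary so that
  the induction hypothesis also covers the upper block.\<close>

lemma card_avoiders_2_13: "real (card (avoiders_2_13 {m..<m + n})) = catalan n"
proof (induction n arbitrary: m rule: less_induct)
  case (less n)
  show ?case
  proof (cases n)
    case 0
    have "avoiders_2_13 {} = {[]}" by (auto simp: avoiders_2_13_iff)
    with 0 show ?thesis by (simp add: catalan_def)
  next
    case (Suc l)
    let ?P = "\<lambda>i. avoiders_2_13 {m..<m + i} \<times> avoiders_2_13 {m + Suc i..<m + Suc i + (l - i)}"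
    let ?f = "\<lambda>i (bs, as). (m + i) # as @ bs"
    \<comment> \<open>The length of \<open>bs\<close> is fixed by its letter set, so the cut between
      \<open>as\<close> and \<open>bs\<close> can be recovered.\<close>
    have inj: "inj_on (?f i) (?P i)" for i
    proof (rule inj_onI)
      fix p q assume "p \<in> ?P i" "q \<in> ?P i" and eq: "?f i p = ?f i q"
      obtain bs as bs' as' where pq: "p = (bs, as)" "q = (bs', as')"
        by (cases p; cases q) blast
      with \<open>p \<in> ?P i\<close> \<open>q \<in> ?P i\<close> have "length bs = length bs'"
        by (metis SigmaD1 avoiders_2_13_iff distinct_card)
      with eq show "p = q" by (simp add: pq)
    qed
    \<comment> \<open>The union is disjoint because the first letter \<open>m + i\<close> determines
      \<open>i\<close>.\<close>
    have "card (avoiders_2_13 {m..<m + n}) = (\<Sum>i\<le>l. card (?f i ` ?P i))"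
      unfolding Suc avoiders_2_13_interval_Suc
      by (rule card_UN_disjoint) (auto simp: finite_avoiders_2_13)
    also have "\<dots> = (\<Sum>i\<le>l. card (?P i))"
      by (rule sum.cong[OF refl], rule card_image, rule inj)
    also have "real \<dots> = (\<Sum>i\<le>l. catalan i * catalan (l - i))"
      unfolding of_nat_sum card_cartesian_product of_nat_mult
      by (rule sum.cong) (auto simp only: atMost_iff less.IH Suc)
    finally show ?thesis
      by (simp add: Suc catalan_convolution)
  qed
qed

section \<open>Avoiders with a decreasing beginning\<close>

text \<open>\<open>rev [1..<k + 1]\<close> is the word k(k-1)...1, with entry \<open>k - i\<close>
  at position \<open>i\<close> counted from 0.\<close>

lemma order_isomorphic_decreasing:
  "order_isomorphic xs (rev [1..<k + 1]) \<longleftrightarrow> length xs = k \<and> sorted_wrt (>) xs"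
proof -
  have nth: "rev [1..<k + 1] ! i = k - i" if "i < k" for i
    using that by (simp add: rev_nth del: upt_Suc)
  show ?thesis
  proof (intro iffI conjI)
    assume L: "order_isomorphic xs (rev [1..<k + 1])"
    then show "length xs = k" by (simp add: order_isomorphic_def)
    with L nth show "sorted_wrt (>) xs"
      by (auto simp: order_isomorphic_def sorted_wrt_iff_nth_less simp del: upt_Suc)
  next
    assume R: "length xs = k \<and> sorted_wrt (>) xs"
    have "xs ! i < xs ! j \<longleftrightarrow> k - i < k - j" if "i < k" "j < k" for i j
      using R that sorted_wrt_nth_less[of "(>)" xs i j] sorted_wrt_nth_less[of "(>)" xs j i]
      by (cases i j rule: linorder_cases) auto
    with R nth show "order_isomorphic xs (rev [1..<k + 1])"
      by (simp add: order_isomorphic_def del: upt_Suc)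
  qed
qed

text \<open>The convention on the empty permutation is left out here: for \<open>k = 1\<close> and
  \<open>n = 0\<close> the set is empty.\<close>

definition decreasing_avoiders :: "nat \<Rightarrow> nat \<Rightarrow> nat list set" where
  "decreasing_avoiders k n =
     {\<pi> \<in> avoiders_2_13 {1..n}. k \<le> length \<pi> \<and> sorted_wrt (>) (take k \<pi>)}"

text \<open>The convention applies only to the empty word and the pattern \<open>[1]\<close>, which
  forces \<open>n = 0\<close> and \<open>k = 1\<close>, the excluded case.\<close>

lemma num_avoiding_beginning_eq_card:
  assumes "k \<ge> 1" "\<not> (k = 1 \<and> n = 0)"
  shows "num_avoiding_beginning contains_2_13 (rev [1..<k + 1]) n = card (decreasing_avoiders k n)"
proof -
  have len: "length (rev [1..<k + 1]) = k"
    by (simp del: upt_Suc)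
  have "begins_with \<pi> (rev [1..<k + 1]) \<longleftrightarrow> k \<le> length \<pi> \<and> sorted_wrt (>) (take k \<pi>)"
    if \<pi>: "\<pi> \<in> permutations_of_set {1..n}" for \<pi>
  proof -
    have "k = 1" if "rev [1..<k + 1] = [1]"
      using arg_cong[OF that, of length] unfolding len by simp
    moreover have "n = 0" if "\<pi> = []"
      using \<pi> that by (simp add: permutations_of_set_def)
    ultimately have "\<not> (\<pi> = [] \<and> rev [1..<k + 1] = [1])"
      using assms(2) by blast
    then show ?thesis
      unfolding begins_with_def order_isomorphic_decreasing len length_take by auto
  qed
  then have "{\<pi> \<in> permutations_of_set {1..n}. \<not> contains_2_13 \<pi> \<and> begins_with \<pi> (rev [1..<k + 1])}
      = decreasing_avoiders k n"
    unfolding decreasing_avoiders_def avoiders_2_13_def by blast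
  then show ?thesis by (simp add: num_avoiding_beginning_def)
qed

text \<open>A descent at the start leaves no room for letters above the first one, which is
  therefore the maximum. Conversely, no ascent jumps over a prepended maximum, and it lengthens the
  decreasing prefix by one.\<close>

lemma decreasing_avoiders_Suc:
  "decreasing_avoiders (Suc (Suc k)) (Suc n) = (#) (Suc n) ` decreasing_avoiders (Suc k) n"
proof (intro equalityI subsetI)
  fix \<pi> assume \<pi>: "\<pi> \<in> decreasing_avoiders (Suc (Suc k)) (Suc n)"
  then obtain x y ys where eq: "\<pi> = x # y # ys"
    by (auto simp: decreasing_avoiders_def Suc_le_length_iff)
  from \<pi> have set: "set (x # y # ys) = {1..Suc n}" and "distinct (x # y # ys)"
    and avoid: "\<not> contains_2_13 (x # y # ys)" and len: "Suc (Suc k) \<le> length (x # y # ys)"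
    and dec: "sorted_wrt (>) (take (Suc (Suc k)) (x # y # ys))"
    unfolding decreasing_avoiders_def avoiders_2_13_iff eq by blast+
  then have notin: "x \<notin> set (y # ys)" and dist: "distinct (y # ys)" and "y < x" by simp_all
  from avoid have avoid': "\<not> contains_2_13 (y # ys)"
    and "successively (\<lambda>y z. y < x \<longrightarrow> \<not> x < z) (y # ys)"
    unfolding contains_2_13_Cons[of x] by blast+
  then obtain as bs where ab: "y # ys = as @ bs" "\<forall>a\<in>set as. x < a" "\<forall>b\<in>set bs. b < x"
    unfolding successively_no_jump_iff[OF notin] by blast
  \<comment> \<open>A nonempty \<open>as\<close> would begin with \<open>y\<close>, but
    \<open>y\<close> is below \<open>x\<close>.\<close>
  with \<open>y < x\<close> have "as = []" by (cases as) auto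
  with ab have less: "\<forall>z\<in>set (y # ys). z < x" by simp
  have "Suc n \<in> set (x # y # ys)" unfolding set by simp
  moreover have "x \<in> {1..Suc n}" unfolding set[symmetric] by simp
  ultimately have x: "x = Suc n" using less by fastforce
  have "set (y # ys) = set (x # y # ys) - {x}"
    using notin by auto
  also have "\<dots> = {1..n}"
    unfolding set unfolding x by auto
  finally have "y # ys \<in> avoiders_2_13 {1..n}"
    using dist avoid' unfolding avoiders_2_13_iff by blast
  then have "y # ys \<in> decreasing_avoiders (Suc k) n"
    using len dec by (simp add: decreasing_avoiders_def)
  then show "\<pi> \<in> (#) (Suc n) ` decreasing_avoiders (Suc k) n"
    unfolding eq x by (rule imageI)
next
  fix \<pi> assume "\<pi> \<in> (#) (Suc n) ` decreasing_avoiders (Suc k) n"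
  then obtain xs where eq: "\<pi> = Suc n # xs" and set: "set xs = {1..n}" and "distinct xs"
    and avoid: "\<not> contains_2_13 xs" and len: "Suc k \<le> length xs"
    and dec: "sorted_wrt (>) (take (Suc k) xs)"
    unfolding decreasing_avoiders_def avoiders_2_13_iff by blast
  have less: "\<forall>x\<in>set xs. x < Suc n" and notin: "Suc n \<notin> set xs"
    unfolding set by auto
  \<comment> \<open>Nothing exceeds \<open>Suc n\<close>, so the upper block is empty and
    \<open>xs\<close> is the lower block.\<close>
  have "successively (\<lambda>y z. y < Suc n \<longrightarrow> \<not> Suc n < z) xs"
    unfolding successively_no_jump_iff[OF notin] using less by (intro exI[of _ "[]"] exI[of _ xs]) simp
  with avoid have "\<not> contains_2_13 \<pi>"
    unfolding eq contains_2_13_Cons by blast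
  moreover have "set \<pi> = {1..Suc n}"
    unfolding eq set_simps set by auto
  moreover have "distinct \<pi>"
    unfolding eq using notin \<open>distinct xs\<close> by simp
  moreover have "sorted_wrt (>) (take (Suc (Suc k)) \<pi>)"
    unfolding eq take_Suc_Cons sorted_wrt.simps using dec less by (blast dest: in_set_takeD)
  ultimately show "\<pi> \<in> decreasing_avoiders (Suc (Suc k)) (Suc n)"
    unfolding decreasing_avoiders_def avoiders_2_13_iff using len eq by simp
qed

text \<open>Each induction step strips the maximum until the prefix has length 1, which every
  nonempty word satisfies; \<open>m\<close> is the invariant difference of word and prefix
  length.\<close>

lemma card_decreasing_avoiders:
  "real (card (decreasing_avoiders (Suc k) (Suc (k + m)))) = catalan (Suc m)"
proof (induction k)
  case 0
  have "take 1 \<pi> = [hd \<pi>] \<and> 1 \<le> length \<pi>" if "\<pi> \<in> avoiders_2_13 {1..Suc m}" for \<pi>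
    using that by (cases \<pi>) (auto simp: avoiders_2_13_iff)
  then have "decreasing_avoiders 1 (Suc m) = avoiders_2_13 {1..<1 + Suc m}"
    by (fastforce simp: decreasing_avoiders_def atLeastLessThanSuc_atLeastAtMost)
  then show ?case using card_avoiders_2_13[of 1 "Suc m"] by simp
next
  case (Suc k)
  then show ?case by (simp add: decreasing_avoiders_Suc card_image)
qed

lemma decreasing_avoiders_empty:
  assumes "n < k"
  shows "decreasing_avoiders k n = {}"
  using assms distinct_card by (fastforce simp: decreasing_avoiders_def avoiders_2_13_iff)

theorem proposition7:
  fixes k n :: nat
  assumes "k \<ge> 1"
    and "\<not> (k = 1 \<and> n = 0)"
  shows "real (num_avoiding_beginning contains_2_13 (rev [1..<k + 1]) n) =
           (if n \<ge> k then catalan (n - k + 1) else 0)"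
proof (cases "n \<ge> k")
  case True
  \<comment> \<open>This puts \<open>k\<close> and \<open>n\<close> into the shape of
    \<open>card_decreasing_avoiders\<close>, with \<open>k - 1\<close> for its \<open>k\<close> and
    \<open>n - k\<close> for \<open>m\<close>.\<close>
  with assms(1) have "k = Suc (k - 1)" "n = Suc (k - 1 + (n - k))" by auto
  then have "real (card (decreasing_avoiders k n)) = catalan (Suc (n - k))"
    by (metis card_decreasing_avoiders)
  with True show ?thesis
    unfolding num_avoiding_beginning_eq_card[OF assms] by simp
next
  case False
  then show ?thesis
    unfolding num_avoiding_beginning_eq_card[OF assms] by (simp add: decreasing_avoiders_empty)
qed

end
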